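(* Let $$\overline{p}=\sup_{P_\rho\in\mathcal{P}_\rho}\Pr_\rho\big(\lambda_i(A(\rho))\in\mathcal{D}^c\ \text{for some } i=1,\dots,n_a\big)$$ be the upper probability that the matrix $A(\rho)$ has at least one eigenvalue in $\mathcal{D}^c$, where $\lambda_1(A(\rho)),\dots,\lambda_{n_a}(A(\rho))$ are the eigenvalues of $A(\rho)$. Then $\overline{p}$ is given by the solution (optimal value) of the following optimization problem, in which $P_{\rho,x,\lambda}$ is the joint cumulative distribution function of the variables $(\rho,x,\lambda)\in\mathbb{R}^{n_\rho}\times\mathbb{C}^{n_a}\times\mathbb{C}$: $$\overline{p}=\sup_{P_{\rho,x,\lambda}}\ \iiint \|x\|^2\,dP_{\rho,x,\lambda}(\rho,x,\lambda)$$ subject to $$\iiint dP_{\rho,x,\lambda}(\rho,x,\lambda)=1,$$ $$\int_{\rho\in\Delta}\int_{\|x\|^2\le 1}\int_{\lambda\in\mathcal{D}^c} dP_{\rho,x,\lambda}(\rho,x,\lambda)=1,$$ $$\int_{\rho\in\Delta}\int_{\|x\|^2\le 1}\int_{\lambda\in\mathcal{D}^c} f_i(\rho)\,dP_{\rho,x,\lambda}(\rho,x,\lambda)=\mu_i,\qquad i=2,\dots,n_f,$$ $$\iiint_{(A(\rho)-\lambda I)x=0} dP_{\rho,x,\lambda}(\rho,x,\lambda)=1.$$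
   Context: Setting. $A(\rho)$ is a real square matrix of size $n_a\times n_a$ whose entries are real polynomials in the uncertain parameter vector $\rho\in\mathbb{R}^{n_\rho}$. The uncertainty set is the compact semialgebraic set $\Delta=\{\rho\in\mathbb{R}^{n_\rho}: g_i(\rho)\ge 0,\ i=1,\dots,n_g\}$, with $g_i$ real polynomials. The stability region $\mathcal{D}\subseteq\mathbb{C}$ is an open set whose complement (instability region) is the closed semialgebraic set $\mathcal{D}^c=\mathbb{C}\setminus\mathcal{D}=\{\lambda=\lambda_{\mathrm{re}}+j\lambda_{\mathrm{im}}\in\mathbb{C}:\ \lambda_{\mathrm{re}},\lambda_{\mathrm{im}}\in\mathbb{R},\ d_i(\lambda_{\mathrm{re}},\lambda_{\mathrm{im}})\ge 0,\ i=1,\dots,n_d\}$, with $d_i$ real polynomials in the two real variables $\lambda_{\mathrm{re}},\lambda_{\mathrm{im}}$. Probabilistic information: $f_1,\dots,f_{n_f}$ are given real polynomials in $\rho$ with $f_1\equiv 1$, and $\mu_1,\dots,\mu_{n_f}\in\mathbb{R}$ are finite and known, with $\mu_1=1$. $\mathcal{P}_\rho$ is the set of all cumulative distribution functions $P_\rho$ of Borel probability measures $\Pr_\rho$ supported on $\Delta$ such that $\int_\Delta f_i(\rho)\,dP_\rho(\rho)=\mu_i$ for $i=1,\dots,n_f$. Borel probability measures and their cumulative distribution functions are used interchangeably. $I$ is the $n_a\times n_a$ identity matrix and $\|\cdot\|$ the Euclidean norm on $\mathbb{C}^{n_a}$. *)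

theory Defs
  imports "HOL-Probability.Probability"
begin

definition basic_semialgebraic :: "nat \<Rightarrow> (nat \<Rightarrow> 'v \<Rightarrow> real) \<Rightarrow> 'v set" where
  "basic_semialgebraic m g = {v. \<forall>i\<in>{1..m}. g i v \<ge> 0}"

definition complex_matrix :: "real^'n^'m \<Rightarrow> complex^'n^'m" where
  "complex_matrix M = (\<chi> i j. complex_of_real (M $ i $ j))"

definition eigenvalues :: "complex^'n^'n \<Rightarrow> complex set" where
  "eigenvalues M = {l. \<exists>v. v \<noteq> 0 \<and> M *v v = l *s v}"

text \<open>Distributions are represented by Borel probability measures instead of cumulative
  distribution functions. As \<open>\<Delta>\<close> will be compact and the \<open>f i\<close> polynomials, the Bochner
  integrals below are integrals of bounded measurable functions.\<close>

definition moment_measures ::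
  "(real^'r) set \<Rightarrow> nat \<Rightarrow> (nat \<Rightarrow> real^'r \<Rightarrow> real) \<Rightarrow> (nat \<Rightarrow> real) \<Rightarrow> (real^'r) measure set" where
  "moment_measures \<Delta> nf f \<mu> =
    {P. prob_space P \<and> sets P = sets borel \<and> emeasure P \<Delta> = 1 \<and>
        (\<forall>i\<in>{1..nf}. (LINT \<rho>:\<Delta>|P. f i \<rho>) = \<mu> i)}"

text \<open>Both optimal values are suprema in the complete lattice \<open>ennreal\<close>, so the supremum over
  an empty feasible set is \<open>0\<close>. All quantities maximised lie in \<open>[0, 1]\<close>.\<close>

definition upper_probability ::
  "(real^'r \<Rightarrow> real^'n^'n) \<Rightarrow> complex set \<Rightarrow> (real^'r) set \<Rightarrow> nat \<Rightarrow>
    (nat \<Rightarrow> real^'r \<Rightarrow> real) \<Rightarrow> (nat \<Rightarrow> real) \<Rightarrow> ennreal" where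
  "upper_probability A D \<Delta> nf f \<mu> =
    (SUP P\<in>moment_measures \<Delta> nf f \<mu>.
      emeasure P {\<rho>. \<exists>l\<in>eigenvalues (complex_matrix (A \<rho>)). l \<in> - D})"

definition feasible_joint_measures ::
  "(real^'r \<Rightarrow> real^'n^'n) \<Rightarrow> complex set \<Rightarrow> (real^'r) set \<Rightarrow> nat \<Rightarrow>
    (nat \<Rightarrow> real^'r \<Rightarrow> real) \<Rightarrow> (nat \<Rightarrow> real) \<Rightarrow> ((real^'r) \<times> (complex^'n) \<times> complex) measure set" where
  "feasible_joint_measures A D \<Delta> nf f \<mu> =
    {Q. sets Q = sets borel \<and>
        emeasure Q UNIV = 1 \<and>
        emeasure Q {(\<rho>, x, l). \<rho> \<in> \<Delta> \<and> (norm x)\<^sup>2 \<le> 1 \<and> l \<in> - D} = 1 \<and>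
        (\<forall>i\<in>{2..nf}.
          (LINT z:{(\<rho>, x, l). \<rho> \<in> \<Delta> \<and> (norm x)\<^sup>2 \<le> 1 \<and> l \<in> - D}|Q. f i (fst z)) = \<mu> i) \<and>
        emeasure Q {(\<rho>, x, l). (complex_matrix (A \<rho>) - mat l) *v x = 0} = 1}"

definition moment_problem_value ::
  "(real^'r \<Rightarrow> real^'n^'n) \<Rightarrow> complex set \<Rightarrow> (real^'r) set \<Rightarrow> nat \<Rightarrow>
    (nat \<Rightarrow> real^'r \<Rightarrow> real) \<Rightarrow> (nat \<Rightarrow> real) \<Rightarrow> ennreal" where
  "moment_problem_value A D \<Delta> nf f \<mu> =
    (SUP Q\<in>feasible_joint_measures A D \<Delta> nf f \<mu>.
      \<integral>\<^sup>+ (\<rho>, x, l). ennreal ((norm x)\<^sup>2) \<partial>Q)"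

end

theory Submission
  imports Defs
begin

text \<open>A feasible joint measure is carried by triples with \<open>\<parallel>x\<parallel> \<le> 1\<close> in which \<open>x \<noteq> 0\<close> forces \<open>l \<in> - D\<close> to be
  an eigenvalue of \<open>A \<rho>\<close>, so its objective value is at most the probability of instability under the
  \<open>\<rho>\<close>-marginal. Conversely, pushing a measure forward along a Borel map that selects a unit
  eigenvector with an eigenvalue in \<open>- D\<close> where there is one, and \<open>(0, l0)\<close> with a fixed \<open>l0 \<in> - D\<close>
  elsewhere, gives a feasible joint measure whose objective value is exactly that probability. The
  selection exists because the unit eigenpairs with eigenvalue in \<open>- D\<close> form compact sets with closed
  graph.\<close>

section \<open>Measurable selection from compact-valued maps\<close>

text \<open>Induction over the directions in \<open>B\<close>: each one cuts the current set down to
  its points of least inner product with that direction. Compactness keeps these faces nonempty, and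
  measurability of all hitting sets of closed sets is the invariant that passes to them. For
  \<open>B = Basis\<close> at most one point is left.\<close>

lemma measurable_lexicographic_refinement:
  fixes \<Phi> :: "'a \<Rightarrow> 'b::euclidean_space set"
  assumes "finite B" "\<And>\<omega>. compact (\<Phi> \<omega>)"
    and "\<forall>F. closed F \<longrightarrow> {\<omega>\<in>space M. \<Phi> \<omega> \<inter> F \<noteq> {}} \<in> sets M"
  shows "\<exists>\<Psi>. (\<forall>\<omega>. compact (\<Psi> \<omega>)) \<and> (\<forall>\<omega>. \<Psi> \<omega> \<subseteq> \<Phi> \<omega>) \<and> (\<forall>\<omega>. \<Phi> \<omega> \<noteq> {} \<longrightarrow> \<Psi> \<omega> \<noteq> {}) \<and>
    (\<forall>F. closed F \<longrightarrow> {\<omega>\<in>space M. \<Psi> \<omega> \<inter> F \<noteq> {}} \<in> sets M) \<and>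
    (\<forall>\<omega>. \<forall>y\<in>\<Psi> \<omega>. \<forall>z\<in>\<Psi> \<omega>. \<forall>b\<in>B. y \<bullet> b = z \<bullet> b)"
  using \<open>finite B\<close>
proof (induction B rule: finite_induct)
  case empty
  show ?case by (rule exI[of _ \<Phi>]) (use assms in auto)
next
  case (insert b B)
  from insert.IH obtain \<Psi> where "\<forall>\<omega>. compact (\<Psi> \<omega>)" "\<forall>\<omega>. \<Psi> \<omega> \<subseteq> \<Phi> \<omega>"
    "\<forall>\<omega>. \<Phi> \<omega> \<noteq> {} \<longrightarrow> \<Psi> \<omega> \<noteq> {}" "\<forall>F. closed F \<longrightarrow> {\<omega>\<in>space M. \<Psi> \<omega> \<inter> F \<noteq> {}} \<in> sets M"
    "\<forall>\<omega>. \<forall>y\<in>\<Psi> \<omega>. \<forall>z\<in>\<Psi> \<omega>. \<forall>b\<in>B. y \<bullet> b = z \<bullet> b"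
    by (elim exE conjE) (rule that)
  note \<Psi> = this[rule_format]
  define \<Theta> where "\<Theta> \<omega> = {y\<in>\<Psi> \<omega>. \<forall>z\<in>\<Psi> \<omega>. y \<bullet> b \<le> z \<bullet> b}" for \<omega>
  have closed_le: "closed {y::'b. y \<bullet> b \<le> c}" for c
    by (intro closed_Collect_le continuous_intros)
  have attains: "\<exists>y\<in>K. \<forall>z\<in>K. y \<bullet> b \<le> z \<bullet> b" if "compact K" "K \<noteq> {}" for K :: "'b set"
    using that by (intro continuous_attains_inf continuous_intros)
  show ?case
  proof (intro exI[of _ \<Theta>] conjI allI impI ballI)
    fix \<omega>
    have "\<Theta> \<omega> = \<Psi> \<omega> \<inter> (\<Inter>z\<in>\<Psi> \<omega>. {y. y \<bullet> b \<le> z \<bullet> b})" by (auto simp: \<Theta>_def)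
    then show "compact (\<Theta> \<omega>)"
      using \<Psi>(1) closed_le by (simp add: compact_Int_closed closed_INT)
    show "\<Theta> \<omega> \<subseteq> \<Phi> \<omega>" using \<Psi>(2) by (auto simp: \<Theta>_def)
    show "\<Theta> \<omega> \<noteq> {}" if "\<Phi> \<omega> \<noteq> {}"
      using attains[OF \<Psi>(1) \<Psi>(3)[OF that]] by (auto simp: \<Theta>_def)
  next
    fix F :: "'b set" assume F: "closed F"
    \<comment> \<open>The minimum of \<open>y \<bullet> b\<close> over \<open>\<Psi> \<omega>\<close> is attained in \<open>F\<close> iff no rational separates it from the
      minimum over \<open>\<Psi> \<omega> \<inter> F\<close>.\<close>
    have eq: "{\<omega>\<in>space M. \<Theta> \<omega> \<inter> F \<noteq> {}} = {\<omega>\<in>space M. \<Psi> \<omega> \<inter> F \<noteq> {}} \<inter>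
        (\<Inter>q::rat. {\<omega>\<in>space M. \<Psi> \<omega> \<inter> (F \<inter> {y. y \<bullet> b \<le> of_rat q}) \<noteq> {}} \<union>
          (space M - {\<omega>\<in>space M. \<Psi> \<omega> \<inter> {y. y \<bullet> b \<le> of_rat q} \<noteq> {}}))" (is "?L = ?R")
    proof (intro equalityI subsetI)
      fix \<omega> assume "\<omega> \<in> ?L"
      then show "\<omega> \<in> ?R" by (fastforce simp: \<Theta>_def intro: order_trans)
    next
      fix \<omega> assume R: "\<omega> \<in> ?R"
      then have ne: "\<Psi> \<omega> \<inter> F \<noteq> {}" and \<omega>: "\<omega> \<in> space M" by auto
      obtain y where y: "y \<in> \<Psi> \<omega> \<inter> F" "\<forall>z\<in>\<Psi> \<omega> \<inter> F. y \<bullet> b \<le> z \<bullet> b"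
        using attains[OF compact_Int_closed[OF \<Psi>(1) F] ne] by auto
      have "y \<bullet> b \<le> z \<bullet> b" if z: "z \<in> \<Psi> \<omega>" for z
      proof (rule ccontr)
        assume "\<not> ?thesis"
        then obtain q where q: "z \<bullet> b < of_rat q" "of_rat q < y \<bullet> b"
          using of_rat_dense[of "z \<bullet> b" "y \<bullet> b"] by auto
        from R have "\<Psi> \<omega> \<inter> (F \<inter> {y. y \<bullet> b \<le> of_rat q}) \<noteq> {} \<or> \<Psi> \<omega> \<inter> {y. y \<bullet> b \<le> of_rat q} = {}"
          by blast
        with z q have "\<Psi> \<omega> \<inter> (F \<inter> {y. y \<bullet> b \<le> of_rat q}) \<noteq> {}" by fastforce
        then obtain w where "w \<in> \<Psi> \<omega> \<inter> F" "w \<bullet> b \<le> of_rat q" by blast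
        with y(2) q(2) show False by force
      qed
      with y \<omega> show "\<omega> \<in> ?L" by (auto simp: \<Theta>_def)
    qed
    \<comment> \<open>The intersection runs over countably many rationals, and half-spaces are
      closed, so the invariant for \<Psi> applies to every set in it.\<close>
    show "{\<omega>\<in>space M. \<Theta> \<omega> \<inter> F \<noteq> {}} \<in> sets M"
      unfolding eq using F closed_le \<Psi>(4)
      by (intro sets.Int sets.countable_INT' sets.Un sets.Diff sets.top) (auto intro!: \<Psi>(4) closed_Int)
  next
    fix \<omega> y z b'
    assume "y \<in> \<Theta> \<omega>" "z \<in> \<Theta> \<omega>" "b' \<in> insert b B"
    then show "y \<bullet> b' = z \<bullet> b'" using \<Psi>(5)[of y \<omega> z b'] by (auto simp: \<Theta>_def intro: antisym)
  qed
qed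

text \<open>Compact-valued case of the Kuratowski--Ryll-Nardzewski selection theorem; the selection is the
  lexicographically smallest point.\<close>

lemma measurable_selection_compact:
  fixes \<Phi> :: "'a \<Rightarrow> 'b::euclidean_space set"
  assumes "\<And>\<omega>. compact (\<Phi> \<omega>)"
    and meas: "\<And>F. closed F \<Longrightarrow> {\<omega>\<in>space M. \<Phi> \<omega> \<inter> F \<noteq> {}} \<in> sets M"
  obtains s where "s \<in> borel_measurable M" "\<And>\<omega>. \<Phi> \<omega> \<noteq> {} \<Longrightarrow> s \<omega> \<in> \<Phi> \<omega>"
    "\<And>\<omega>. \<Phi> \<omega> = {} \<Longrightarrow> s \<omega> = c"
proof -
  have "\<forall>F. closed F \<longrightarrow> {\<omega>\<in>space M. \<Phi> \<omega> \<inter> F \<noteq> {}} \<in> sets M"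
    using meas by blast
  from measurable_lexicographic_refinement[OF finite_Basis assms(1) this]
  obtain \<Psi> where "\<forall>\<omega>. compact (\<Psi> \<omega>)" and "\<forall>\<omega>. \<Psi> \<omega> \<subseteq> \<Phi> \<omega>"
    "\<forall>\<omega>. \<Phi> \<omega> \<noteq> {} \<longrightarrow> \<Psi> \<omega> \<noteq> {}" "\<forall>F. closed F \<longrightarrow> {\<omega>\<in>space M. \<Psi> \<omega> \<inter> F \<noteq> {}} \<in> sets M"
    "\<forall>\<omega>. \<forall>y\<in>\<Psi> \<omega>. \<forall>z\<in>\<Psi> \<omega>. \<forall>b\<in>Basis. y \<bullet> b = z \<bullet> b"
    by (elim exE conjE) (rule that)
  note \<Psi> = this(2-)[rule_format]
  \<comment> \<open>\<open>SOME\<close> makes no real choice here, since points of \<Psi> \<omega>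
    agree in every coordinate.\<close>
  define s where "s \<omega> = (if \<Psi> \<omega> = {} then c else SOME y. y \<in> \<Psi> \<omega>)" for \<omega>
  have s: "\<Psi> \<omega> = {s \<omega>}" if "\<Psi> \<omega> \<noteq> {}" for \<omega>
  proof -
    have "s \<omega> \<in> \<Psi> \<omega>" using that by (auto simp: s_def some_in_eq)
    moreover have "y = s \<omega>" if "y \<in> \<Psi> \<omega>" for y
      using \<Psi>(4)[OF that \<open>s \<omega> \<in> \<Psi> \<omega>\<close>] by (rule euclidean_eqI)
    ultimately show ?thesis by blast
  qed
  have mem: "s \<omega> \<in> F \<longleftrightarrow> \<Psi> \<omega> \<inter> F \<noteq> {} \<or> \<Psi> \<omega> = {} \<and> c \<in> F" for \<omega> F
  proof (cases "\<Psi> \<omega> = {}")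
    case True
    then show ?thesis by (simp add: s_def)
  next
    case False
    from s[OF this] show ?thesis by simp
  qed
  show ?thesis
  proof
    \<comment> \<open>Closed sets generate the Borel sets, and by \<open>mem\<close> the preimage of
      one is a hitting set of \<Psi>, up to the points where the default \<open>c\<close> is taken;
      hitting \<open>UNIV\<close> detects nonemptiness.\<close>
    have "s \<in> measurable M (sigma UNIV (Collect closed))"
    proof (rule measurable_measure_of)
      fix F :: "'b set" assume "F \<in> Collect closed"
      then have F: "{\<omega>\<in>space M. \<Psi> \<omega> \<inter> F \<noteq> {}} \<in> sets M"
          "{\<omega>\<in>space M. \<Psi> \<omega> \<inter> UNIV \<noteq> {}} \<in> sets M"
        using \<Psi>(3)[of F] \<Psi>(3)[of UNIV] by auto
      have "s -` F \<inter> space M = {\<omega>\<in>space M. \<Psi> \<omega> \<inter> F \<noteq> {}} \<union>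
          (if c \<in> F then space M - {\<omega>\<in>space M. \<Psi> \<omega> \<inter> UNIV \<noteq> {}} else {})"
        using mem by auto
      then show "s -` F \<inter> space M \<in> sets M" using F by auto
    qed auto
    then show "s \<in> borel_measurable M" by (simp add: borel_eq_closed)
    fix \<omega>
    show "s \<omega> \<in> \<Phi> \<omega>" if "\<Phi> \<omega> \<noteq> {}" using s[OF \<Psi>(2)[OF that]] \<Psi>(1)[of \<omega>] by auto
    show "s \<omega> = c" if "\<Phi> \<omega> = {}" using \<Psi>(1)[of \<omega>] that by (simp add: s_def)
  qed
qed

text \<open>A projection along a compact factor preserves closedness. Exhausting the second factor
  by balls therefore gives a countable union of closed sets.\<close>

lemma borel_projection_closed:
  fixes S :: "('a::euclidean_space \<times> 'b::euclidean_space) set"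
  assumes "closed S"
  shows "{a. \<exists>y. (a, y) \<in> S} \<in> sets borel"
proof -
  have "{a. \<exists>y. (a, y) \<in> S} = (\<Union>n::nat. {a. \<exists>y. y \<in> cball 0 (real n) \<and> (a, y) \<in> S})"
    using real_arch_simple by fastforce
  moreover have "closed {a. \<exists>y. y \<in> cball 0 (real n) \<and> (a, y) \<in> S}" for n :: nat
  proof -
    \<comment> \<open>\<open>closed_compact_projection\<close> expects the compact coordinate
      first.\<close>
    have "closed (prod.swap -` S)"
      using assms by (intro closed_vimage) (auto intro!: continuous_intros simp: prod.swap_def)
    from closed_compact_projection[OF compact_cball this, of 0 "real n"] show ?thesis by simp
  qed
  ultimately show ?thesis by auto
qed

section \<open>Unit eigenpairs with eigenvalue in a closed set\<close>

lemma mat_mult_vec: "mat l *v x = l *s (x :: 'a::semiring_1^'n)"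
  by (simp add: vec_eq_iff matrix_vector_mult_def mat_def if_distrib[of "\<lambda>a. a * _"] cong: if_cong)

lemma complex_norm_vector_scalar_mult: "norm (l *s (x :: complex^'n)) = norm l * norm x"
  by (simp add: norm_vec_def norm_mult L2_set_right_distrib)

lemma complex_vector_normalize:
  fixes v :: "complex^'n"
  assumes "v \<noteq> 0"
  obtains c where "norm (c *s v) = 1"
proof
  show "norm (complex_of_real (inverse (norm v)) *s v) = 1"
    using assms by (simp only: complex_norm_vector_scalar_mult norm_of_real) simp
qed

text \<open>Normalising the eigenvector excludes zero and makes the set bounded, hence compact for
  closed \<open>E\<close>. The residual form of the equation matches the constraint on joint
  measures.\<close>

definition unit_eigenpairs :: "complex set \<Rightarrow> complex^'n^'n \<Rightarrow> ((complex^'n) \<times> complex) set" where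
  "unit_eigenpairs E M = {(x, l). norm x = 1 \<and> l \<in> E \<and> (M - mat l) *v x = 0}"

text \<open>An eigenvector can be rescaled to norm one without changing its eigenvalue. This turns
  instability into nonemptiness of a set from which one can select.\<close>

lemma unit_eigenpairs_nonempty_iff:
  "unit_eigenpairs E M \<noteq> {} \<longleftrightarrow> (\<exists>l\<in>eigenvalues M. l \<in> E)"
proof
  assume "unit_eigenpairs E M \<noteq> {}"
  then obtain x l where "norm x = 1" "l \<in> E" "M *v x = l *s x"
    by (auto simp: unit_eigenpairs_def matrix_vector_mult_diff_rdistrib mat_mult_vec)
  then show "\<exists>l\<in>eigenvalues M. l \<in> E"
    unfolding eigenvalues_def by (metis (mono_tags, lifting) mem_Collect_eq norm_zero zero_neq_one)
next
  assume "\<exists>l\<in>eigenvalues M. l \<in> E"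
  then obtain v l where v: "v \<noteq> 0" "l \<in> E" "M *v v = l *s v"
    by (auto simp: eigenvalues_def)
  obtain c where c: "norm (c *s v) = 1" using complex_vector_normalize[OF v(1)] .
  have "M *v (c *s v) = l *s (c *s v)"
    by (simp add: vec.scale v(3) vector_smult_assoc mult.commute)
  with c v(2) have "(c *s v, l) \<in> unit_eigenpairs E M"
    by (simp add: unit_eigenpairs_def matrix_vector_mult_diff_rdistrib mat_mult_vec)
  then show "unit_eigenpairs E M \<noteq> {}" by blast
qed

lemma continuous_on_eigen_residual:
  fixes M :: "'a::topological_space \<Rightarrow> complex^'n^'n"
  assumes "\<And>i j. continuous_on UNIV (\<lambda>\<rho>. M \<rho> $ i $ j)"
  shows "continuous_on UNIV (\<lambda>z. (M (fst z) - mat (snd (snd z))) *v (fst (snd z)))"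
proof -
  have M: "continuous_on UNIV (\<lambda>z. M (fst z) $ i $ j)" for i j
    by (rule continuous_on_compose2[OF assms]) (auto intro: continuous_intros)
  show ?thesis
    unfolding matrix_vector_mult_diff_rdistrib mat_mult_vec
    unfolding matrix_vector_mult_def vector_scalar_mult_def
    by (intro M continuous_intros)
qed

text \<open>Three closed conditions on the triple are intersected: the unit sphere,
  \<open>E\<close>, and the zero set of the jointly continuous residual.\<close>

lemma closed_unit_eigenpairs_graph:
  fixes M :: "'a::euclidean_space \<Rightarrow> complex^'n^'n"
  assumes "\<And>i j. continuous_on UNIV (\<lambda>\<rho>. M \<rho> $ i $ j)" "closed E"
  shows "closed {(\<rho>, y). y \<in> unit_eigenpairs E (M \<rho>)}"
proof -
  have "{(\<rho>, y). y \<in> unit_eigenpairs E (M \<rho>)} =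
      {z. norm (fst (snd z)) = 1} \<inter> (\<lambda>z. snd (snd z)) -` E \<inter>
      {z. (M (fst z) - mat (snd (snd z))) *v (fst (snd z)) = 0}"
    by (auto simp: unit_eigenpairs_def)
  also have "closed \<dots>"
    using assms continuous_on_eigen_residual[of M]
    by (intro closed_Int closed_Collect_eq closed_vimage) (auto intro!: continuous_intros)
  finally show ?thesis .
qed

text \<open>On the unit sphere \<open>norm l = norm (l *s x) = norm (M *v x)\<close>, which is
  bounded by compactness of the sphere.\<close>

lemma compact_unit_eigenpairs:
  assumes "closed E"
  shows "compact (unit_eigenpairs E (M :: complex^'n^'n))"
proof -
  \<comment> \<open>Closedness is read off a slice of the graph of a constant family; the real
    parameter is a dummy.\<close>
  have "closed (Pair (0::real) -` {(\<rho>, y). y \<in> unit_eigenpairs E M})"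
    using closed_unit_eigenpairs_graph[of "\<lambda>_::real. M" E] assms
    by (intro closed_vimage) (auto intro: continuous_intros)
  then have closed: "closed (unit_eigenpairs E M)" by (simp add: vimage_def)
  have "compact ((*v) M ` sphere 0 1)"
    by (intro compact_continuous_image continuous_intros) auto
  then obtain b where b: "\<And>x. x \<in> sphere 0 1 \<Longrightarrow> norm (M *v x) \<le> b"
    by (meson bounded_iff compact_imp_bounded imageI)
  have "unit_eigenpairs E M \<subseteq> sphere 0 1 \<times> cball 0 b"
  proof safe
    fix x l assume "(x, l) \<in> unit_eigenpairs E M"
    then have "norm x = 1" "M *v x = l *s x"
      by (auto simp: unit_eigenpairs_def matrix_vector_mult_diff_rdistrib mat_mult_vec)
    then show "x \<in> sphere 0 1" "l \<in> cball 0 b"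
      using b[of x] by (auto simp: complex_norm_vector_scalar_mult)
  qed
  then have "bounded (unit_eigenpairs E M)"
    by (rule bounded_subset[rotated]) (simp add: bounded_Times)
  with closed show ?thesis by (simp add: compact_eq_bounded_closed)
qed

text \<open>The parameters whose eigenpairs hit a closed \<open>F\<close> form the projection of the
  closed graph cut with \<open>UNIV \<times> F\<close>, so they form a Borel set and compact
  selection applies.\<close>

lemma measurable_eigenpair_selection:
  fixes M :: "'a::euclidean_space \<Rightarrow> complex^'n^'n"
  assumes cont: "\<And>i j. continuous_on UNIV (\<lambda>\<rho>. M \<rho> $ i $ j)" and E: "closed E"
  obtains (selection) s where "s \<in> borel_measurable borel"
    "\<And>\<rho>. unit_eigenpairs E (M \<rho>) \<noteq> {} \<Longrightarrow> s \<rho> \<in> unit_eigenpairs E (M \<rho>)"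
    "\<And>\<rho>. unit_eigenpairs E (M \<rho>) = {} \<Longrightarrow> s \<rho> = c"
proof (rule measurable_selection_compact[of "\<lambda>\<rho>. unit_eigenpairs E (M \<rho>)" borel, where c = c])
  fix F :: "((complex^'n) \<times> complex) set" assume "closed F"
  then have "closed ({(\<rho>, y). y \<in> unit_eigenpairs E (M \<rho>)} \<inter> UNIV \<times> F)"
    using closed_unit_eigenpairs_graph[OF cont E] by (intro closed_Int closed_Times) auto
  from borel_projection_closed[OF this]
  show "{\<rho> \<in> space borel. unit_eigenpairs E (M \<rho>) \<inter> F \<noteq> {}} \<in> sets borel"
    by (simp add: ex_in_conv[symmetric])
next
  show thesis if "s \<in> borel_measurable borel"
    "\<And>\<rho>. unit_eigenpairs E (M \<rho>) \<noteq> {} \<Longrightarrow> s \<rho> \<in> unit_eigenpairs E (M \<rho>)"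
    "\<And>\<rho>. unit_eigenpairs E (M \<rho>) = {} \<Longrightarrow> s \<rho> = c" for s
    using that by (rule selection)
qed (rule compact_unit_eigenpairs[OF E])

text \<open>The set is a projection of the closed graph. Measurability matters because
  \<open>emeasure\<close> is 0 by convention outside the sigma-algebra.\<close>

lemma unstable_parameters_borel:
  fixes M :: "'a::euclidean_space \<Rightarrow> complex^'n^'n"
  assumes "\<And>i j. continuous_on UNIV (\<lambda>\<rho>. M \<rho> $ i $ j)" "closed E"
  shows "{\<rho>. \<exists>l\<in>eigenvalues (M \<rho>). l \<in> E} \<in> sets borel"
  using borel_projection_closed[OF closed_unit_eigenpairs_graph[OF assms]]
  by (simp add: unit_eigenpairs_nonempty_iff[symmetric] ex_in_conv[symmetric])

section \<open>Equality of the two optimal values\<close>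

theorem theorem3:
  fixes A :: "real^'r \<Rightarrow> real^'n^'n"
    and g :: "nat \<Rightarrow> real^'r \<Rightarrow> real" and ng :: nat and \<Delta> :: "(real^'r) set"
    and d :: "nat \<Rightarrow> real \<times> real \<Rightarrow> real" and nd :: nat and D :: "complex set"
    and f :: "nat \<Rightarrow> real^'r \<Rightarrow> real" and nf :: nat and \<mu> :: "nat \<Rightarrow> real"
  assumes "\<And>i j. real_polynomial_function (\<lambda>\<rho>. A \<rho> $ i $ j)"
    and "\<And>i. i \<in> {1..ng} \<Longrightarrow> real_polynomial_function (g i)"
    and "\<Delta> = basic_semialgebraic ng g"
    and "compact \<Delta>"
    and "\<And>i. i \<in> {1..nd} \<Longrightarrow> real_polynomial_function (d i)"
    and "open D"
    and "- D = {l. (Re l, Im l) \<in> basic_semialgebraic nd d}"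
    and "nf \<ge> 1"
    and "\<And>i. i \<in> {1..nf} \<Longrightarrow> real_polynomial_function (f i)"
    and "f 1 = (\<lambda>\<rho>. 1)"
    and "\<mu> 1 = 1"
  shows "upper_probability A D \<Delta> nf f \<mu> = moment_problem_value A D \<Delta> nf f \<mu>"
proof (rule antisym)
  define M where "M \<rho> = complex_matrix (A \<rho>)" for \<rho>
  define B where "B = {\<rho>. \<exists>l\<in>eigenvalues (M \<rho>). l \<in> - D}"
  define C :: "((real^'r) \<times> (complex^'n) \<times> complex) set"
    where "C = {(\<rho>, x, l). \<rho> \<in> \<Delta> \<and> (norm x)\<^sup>2 \<le> 1 \<and> l \<in> - D}"
  define K :: "((real^'r) \<times> (complex^'n) \<times> complex) set"
    where "K = {(\<rho>, x, l). (M \<rho> - mat l) *v x = 0}"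
  have contM: "continuous_on UNIV (\<lambda>\<rho>. M \<rho> $ i $ j)" for i j
    using assms(1)[of i j]
    by (auto simp: M_def complex_matrix_def real_polynomial_function_eq continuous_on_eq_continuous_within
        intro!: continuous_intros continuous_polymonial_function)
  have closedD: "closed (- D)" using assms(6) by (simp add: closed_Compl)
  have B: "B \<in> sets borel"
    unfolding B_def by (rule unstable_parameters_borel[OF contM closedD])
  have B_iff: "\<rho> \<in> B \<longleftrightarrow> unit_eigenpairs (- D) (M \<rho>) \<noteq> {}" for \<rho>
    by (simp add: B_def unit_eigenpairs_nonempty_iff)
  have \<Delta>: "\<Delta> \<in> sets borel" using assms(4) by (simp add: compact_imp_closed)
  have f: "f i \<in> borel_measurable borel" if "i \<in> {1..nf}" for i
    using continuous_real_polymonial_function[OF assms(9)[OF that]]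
    by (intro borel_measurable_continuous_onI) (simp add: continuous_at_imp_continuous_on)
  have "C = \<Delta> \<times> cball 0 1 \<times> - D"
    by (auto simp: C_def power_le_one_iff)
  then have C: "C \<in> sets borel"
    using assms(4) closedD by (simp add: compact_imp_closed closed_Times)
  have "K = {z. (M (fst z) - mat (snd (snd z))) *v (fst (snd z)) = 0}"
    by (auto simp: K_def)
  then have K: "K \<in> sets borel"
    using continuous_on_eigen_residual[OF contM] by (simp add: closed_Collect_eq)
  have fst_borel: "(fst :: (real^'r) \<times> (complex^'n) \<times> complex \<Rightarrow> _) \<in> measurable borel borel"
    by (intro borel_measurable_continuous_onI continuous_intros)

  \<comment> \<open>Lifting a parameter distribution to a joint measure\<close>
  show "upper_probability A D \<Delta> nf f \<mu> \<le> moment_problem_value A D \<Delta> nf f \<mu>"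
    unfolding upper_probability_def M_def[symmetric] B_def[symmetric]
  proof (rule SUP_least)
    fix P assume "P \<in> moment_measures \<Delta> nf f \<mu>"
    then have "prob_space P" and sets_P: "sets P = sets borel" and P\<Delta>: "emeasure P \<Delta> = 1"
      and P\<mu>: "\<And>i. i \<in> {1..nf} \<Longrightarrow> (LINT \<rho>:\<Delta>|P. f i \<rho>) = \<mu> i"
      by (auto simp: moment_measures_def)
    interpret P: prob_space P by fact
    show "emeasure P B \<le> moment_problem_value A D \<Delta> nf f \<mu>"
    \<comment> \<open>If \<open>- D\<close> is empty there is no \<open>l0\<close> to serve as
      default, but then \<open>B\<close> is empty and its measure is 0.\<close>
    proof (cases "D = UNIV")
      case True
      then have "B = {}" by (simp add: B_def)
      then show ?thesis by simp
    next
      case False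
      then obtain l0 where l0: "l0 \<in> - D" by blast
      \<comment> \<open>The default \<open>(0, l0)\<close> satisfies the eigenvector equation
        trivially, respects the support constraint and adds nothing to the objective.\<close>
      obtain s where s: "s \<in> borel_measurable borel"
        "\<And>\<rho>. \<rho> \<in> B \<Longrightarrow> s \<rho> \<in> unit_eigenpairs (- D) (M \<rho>)" "\<And>\<rho>. \<rho> \<notin> B \<Longrightarrow> s \<rho> = (0, l0)"
        using measurable_eigenpair_selection[OF contM closedD, of "(0, l0)"] B_iff by metis
      define h where "h \<rho> = (\<rho>, s \<rho>)" for \<rho>
      define Q where "Q = distr P borel h"
      have h: "h \<in> measurable P borel"
        unfolding measurable_cong_sets[OF sets_P refl] h_def[abs_def]
        using s(1) by (intro borel_measurable_Pair) auto
      have space_P: "space P = UNIV" using sets_eq_imp_space_eq[OF sets_P] by simp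
      have norm_s: "norm (fst (s \<rho>)) = indicator B \<rho>" for \<rho>
        using s(2,3)[of \<rho>] by (cases "\<rho> \<in> B") (auto simp: unit_eigenpairs_def)
      have hC: "h \<rho> \<in> C \<longleftrightarrow> \<rho> \<in> \<Delta>" for \<rho>
        using s(2,3)[of \<rho>] l0 by (cases "\<rho> \<in> B") (auto simp: h_def C_def unit_eigenpairs_def)
      have hK: "h \<rho> \<in> K" for \<rho>
        using s(2,3)[of \<rho>] by (cases "\<rho> \<in> B") (auto simp: h_def K_def unit_eigenpairs_def)
      have "Q \<in> feasible_joint_measures A D \<Delta> nf f \<mu>"
        unfolding feasible_joint_measures_def M_def[symmetric] C_def[symmetric] K_def[symmetric]
      proof (intro CollectI conjI ballI)
        show "sets Q = sets borel" by (simp add: Q_def)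
        show "emeasure Q UNIV = 1"
          using h P.emeasure_space_1 by (simp add: Q_def emeasure_distr space_P)
        \<comment> \<open>These preimages reduce the mass constraints on \<open>Q\<close> to those
          on \<open>P\<close>.\<close>
        have "h -` C = \<Delta>" "h -` K = UNIV" using hC hK unfolding vimage_def by blast+
        then show "emeasure Q C = 1" "emeasure Q K = 1"
          using h C K P\<Delta> P.emeasure_space_1 by (simp_all add: Q_def emeasure_distr space_P)
        fix i assume "i \<in> {2..nf}"
        then have i: "i \<in> {1..nf}" by simp
        have "(\<lambda>z. indicator C z *\<^sub>R f i (fst z)) \<in> borel_measurable borel"
          using C measurable_compose[OF fst_borel f[OF i]] by measurable
        then have "(LINT z:C|Q. f i (fst z)) = (LINT \<rho>|P. indicator C (h \<rho>) *\<^sub>R f i (fst (h \<rho>)))"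
          unfolding set_lebesgue_integral_def Q_def by (rule integral_distr[OF h])
        also have "\<dots> = (LINT \<rho>:\<Delta>|P. f i \<rho>)"
          using hC by (simp add: set_lebesgue_integral_def indicator_def h_def)
        finally show "(LINT z:C|Q. f i (fst z)) = \<mu> i" using P\<mu>[OF i] by simp
      qed
      moreover have "(\<integral>\<^sup>+ (\<rho>, x, l). ennreal ((norm x)\<^sup>2) \<partial>Q) = emeasure P B"
      proof -
        \<comment> \<open>By \<open>norm_s\<close> the objective pulls back along \<open>h\<close>
          to the indicator of \<open>B\<close>.\<close>
        have "(\<lambda>(\<rho>, x, l). ennreal ((norm x)\<^sup>2)) \<in> borel_measurable (borel :: ((real^'r) \<times> (complex^'n) \<times> complex) measure)"
          by (simp add: borel_prod[symmetric])
        then have "(\<integral>\<^sup>+ (\<rho>, x, l). ennreal ((norm x)\<^sup>2) \<partial>Q) = (\<integral>\<^sup>+ \<rho>. indicator B \<rho> \<partial>P)"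
          unfolding Q_def
          by (subst nn_integral_distr[OF h])
            (auto simp: h_def norm_s split_beta indicator_def intro!: nn_integral_cong)
        then show ?thesis using B sets_P by simp
      qed
      ultimately show ?thesis
        unfolding moment_problem_value_def by (metis (no_types, lifting) SUP_upper)
    qed
  qed

  \<comment> \<open>Projecting a joint measure to its parameter marginal\<close>
  show "moment_problem_value A D \<Delta> nf f \<mu> \<le> upper_probability A D \<Delta> nf f \<mu>"
    unfolding moment_problem_value_def
  proof (rule SUP_least)
    fix Q assume "Q \<in> feasible_joint_measures A D \<Delta> nf f \<mu>"
    then have sets_Q: "sets Q = sets borel" and Q1: "emeasure Q UNIV = 1"
      and QC: "emeasure Q C = 1" and QK: "emeasure Q K = 1"
      and Q\<mu>: "\<And>i. i \<in> {2..nf} \<Longrightarrow> (LINT z:C|Q. f i (fst z)) = \<mu> i"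
      by (auto simp: feasible_joint_measures_def C_def K_def M_def)
    have space_Q: "space Q = UNIV" using sets_eq_imp_space_eq[OF sets_Q] by simp
    interpret Q: prob_space Q by (rule prob_spaceI) (simp add: space_Q Q1)
    define P where "P = distr Q borel fst"
    have fst_Q: "fst \<in> measurable Q borel"
      using fst_borel by (simp add: measurable_cong_sets[OF sets_Q refl])
    have AE_C: "AE z in Q. z \<in> C" and AE_K: "AE z in Q. z \<in> K"
      using QC QK C K by (auto intro!: Q.AE_I_eq_1 simp: sets_Q space_Q)
    have "P \<in> moment_measures \<Delta> nf f \<mu>"
      unfolding moment_measures_def
    proof (intro CollectI conjI ballI)
      show "prob_space P" unfolding P_def by (rule Q.prob_space_distr[OF fst_Q])
      show "sets P = sets borel" by (simp add: P_def)
      have "AE z in Q. z \<in> fst -` \<Delta> \<inter> space Q"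
        using AE_C by eventually_elim (auto simp: C_def space_Q)
      then show P\<Delta>: "emeasure P \<Delta> = 1"
        using \<Delta> fst_Q by (simp add: P_def emeasure_distr Q.emeasure_eq_1_AE measurable_sets)
      fix i assume i: "i \<in> {1..nf}"
      show "(LINT \<rho>:\<Delta>|P. f i \<rho>) = \<mu> i"
      \<comment> \<open>The joint constraints start at 2; for index 1 the moment is the mass of
        \<Delta>, which is 1.\<close>
      proof (cases "i = 1")
        case True
        then show ?thesis
          using assms(10,11) P\<Delta> \<Delta> by (simp add: set_lebesgue_integral_def measure_def P_def)
      next
        case False
        with i have i2: "i \<in> {2..nf}" by simp
        have meas: "(\<lambda>\<rho>. indicator \<Delta> \<rho> *\<^sub>R f i \<rho>) \<in> borel_measurable borel"
          using \<Delta> f[OF i] by measurable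
        have "(LINT \<rho>:\<Delta>|P. f i \<rho>) = (LINT z|Q. indicator \<Delta> (fst z) *\<^sub>R f i (fst z))"
          unfolding set_lebesgue_integral_def P_def by (rule integral_distr[OF fst_Q meas])
        \<comment> \<open>Both indicators equal 1 almost everywhere, because \<open>Q\<close> is
          carried by \<open>C\<close>.\<close>
        also have "\<dots> = (LINT z:C|Q. f i (fst z))"
          unfolding set_lebesgue_integral_def
        proof (rule integral_cong_AE)
          show "AE z in Q. indicator \<Delta> (fst z) *\<^sub>R f i (fst z) = indicator C z *\<^sub>R f i (fst z)"
            using AE_C by eventually_elim (auto simp: C_def)
          show "(\<lambda>z. indicator \<Delta> (fst z) *\<^sub>R f i (fst z)) \<in> borel_measurable Q"
            by (rule measurable_compose[OF fst_Q meas])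
          have "C \<in> sets Q" using C sets_Q by simp
          then show "(\<lambda>z. indicator C z *\<^sub>R f i (fst z)) \<in> borel_measurable Q"
            using measurable_compose[OF fst_Q f[OF i]] by measurable
        qed
        finally show ?thesis using Q\<mu>[OF i2] by simp
      qed
    qed
    moreover have "(\<integral>\<^sup>+ (\<rho>, x, l). ennreal ((norm x)\<^sup>2) \<partial>Q) \<le> emeasure P B"
    proof -
      have "AE z in Q. (case z of (\<rho>, x, l) \<Rightarrow> ennreal ((norm x)\<^sup>2)) \<le> indicator (fst -` B) z"
        using AE_C AE_K
      proof eventually_elim
        case (elim z)
        obtain \<rho> x l where z: "z = (\<rho>, x, l)" by (cases z)
        \<comment> \<open>A nonzero \<open>x\<close> is an eigenvector for
          \<open>l \<in> - D\<close>. The integrand is thus 0 off \<open>B\<close>, and at most 1 on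
          it by the norm bound in \<open>C\<close>.\<close>
        have "x = 0 \<or> \<rho> \<in> B"
          using elim
          by (auto simp: z C_def K_def B_def eigenvalues_def matrix_vector_mult_diff_rdistrib mat_mult_vec)
        with elim show ?case by (auto simp: z C_def indicator_def)
      qed
      then have "(\<integral>\<^sup>+ (\<rho>, x, l). ennreal ((norm x)\<^sup>2) \<partial>Q) \<le> (\<integral>\<^sup>+ z. indicator (fst -` B) z \<partial>Q)"
        by (rule nn_integral_mono_AE)
      also have "\<dots> = emeasure P B"
        using measurable_sets[OF fst_Q B] B fst_Q by (simp add: P_def emeasure_distr space_Q)
      finally show ?thesis .
    qed
    ultimately show "(\<integral>\<^sup>+ (\<rho>, x, l). ennreal ((norm x)\<^sup>2) \<partial>Q) \<le> upper_probability A D \<Delta> nf f \<mu>"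
      unfolding upper_probability_def M_def[symmetric] B_def[symmetric] by (rule SUP_upper2)
  qed
qed

end
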